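(* In the algorithm \texttt{mQ-learning-intervals} (described in the context), fix a player, a step $h\in[H]$ and a state-action pair $(x,\bm{a})\in\mathcal{S}\times\mathcal{A}$. After $(x,\bm{a})$ has been visited $t\ge1$ times (at step $h$), the values $Q^{\text{up}}(x,\bm{a};t)$ and $Q^{\text{low}}(x,\bm{a};t)$ of that player's upper and lower tables at $(x,\bm{a})$ satisfy $$Q^{\text{up}}(x,\bm{a};t)-Q^{\text{low}}(x,\bm{a};t)=2\sum_{i=1}^t\alpha_t^i b_i.$$
   Context: **Setting (Problem B).** $M$ players act in an episodic tabular MDP with finite state space $\mathcal{S}$, joint action space $\mathcal{A}=\mathcal{A}_1\times\cdots\times\mathcal{A}_M$ and horizon $H\ge1$; $[H]=\{1,\dots,H\}$. All players observe the states and the joint actions; player $m$ observes only its own reward $r_h^m\in[0,1]$. **Weights.** $\alpha_t=\frac{H+1}{H+t}$ for $t\ge1$, and $\alpha_t^i=\alpha_i\prod_{j=i+1}^t(1-\alpha_j)$ for $1\le i\le t$. The bonus is $b_t=c\sqrt{H^3\iota/t}$, where $c>0$ and $\iota>0$ are fixed numbers. **Lexicographic order.** $\bm{x}<\bm{y}$ iff there is $n$ with $x_j=y_j$ for all $j<n$ and $x_n<y_n$. **Algorithm \texttt{mQ-learning-intervals} (run by each player $m$ on its own tables).** Initialize $Q^{\text{up}}_h(m,x,\bm{a})=H$, $Q^{\text{low}}_h(m,x,\bm{a})=0$, $N_h(m,x,\bm{a})=0$ for all $(x,\bm{a},h)$, $V_h(m,x)=H$ for $h\le H$, $V_{H+1}\equiv0$;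 the "desired set" of each state is initially $\mathcal{A}$. In each episode, for $h=1,\dots,H$: (1) let $\bm{a}$ be the action in the desired set of the current state $x_h$ pulled the fewest times, ties broken lexicographically (smallest); (2) each player $m$ for which some $\bm{a}'$ has $Q_h^{\text{up}}(m,x_h,\bm{a})<Q_h^{\text{low}}(m,x_h,\bm{a}')$ deviates from its component of $\bm{a}$, the others play their components; (3) the realized joint action $\bm{a}_h$ is observed by all; if $\bm{a}_h\neq\bm{a}$, $\bm{a}$ is eliminated from the desired set of $x_h$; (4) player $m$ observes $r_h^m$ and the next state $x_{h+1}$; (5) increment $N_h(m,x_h,\bm{a}_h)$ and call the new value $t$ (the number of visits to $(x_h,\bm{a}_h)$ at step $h$); (6) set $Q_h^{\text{up}}(m,x_h,\bm{a}_h)\leftarrow(1-\alpha_t)Q_h^{\text{up}}(m,x_h,\bm{a}_h)+\alpha_t[r_h^m+V_{h+1}(m,x_{h+1})+b_t]$ and $Q_h^{\text{low}}(m,x_h,\bm{a}_h)\leftarrow(1-\alpha_t)Q_h^{\text{low}}(m,x_h,\bm{a}_h)+\alpha_t[r_h^m+V_{h+1}(m,x_{h+1})-b_t]$, with the same $V_{h+1}(m,x_{h+1})$ in both; (7) set $V_h(m,x_h)\leftarrow\min\{H,\max_{\bm{a}'}Q_h^{\text{up}}(m,x_h,\bm{a}')\}$. *)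

theory Defs
  imports "HOL-Probability.Probability_Mass_Function"
begin

text \<open>
  The individual action sets are subsets of one linearly ordered type. Players and steps are
  numbered from 1. A joint action is a function that is \<^const>\<open>undefined\<close> outside of the players.
\<close>

type_synonym 'a joint = "nat \<Rightarrow> 'a"

record ('s, 'a) mdp =
  players :: nat
  states :: "'s set"
  actions :: "nat \<Rightarrow> 'a set"
  horizon :: nat
  transition :: "nat \<Rightarrow> 's \<Rightarrow> 'a joint \<Rightarrow> 's pmf"

definition joint_actions :: "('s, 'a) mdp \<Rightarrow> 'a joint set" where
  "joint_actions G = (\<Pi>\<^sub>E m\<in>{1..players G}. actions G m)"

definition episodic_mdp :: "('s, 'a) mdp \<Rightarrow> bool" where
  "episodic_mdp G \<longleftrightarrow>
     players G \<ge> 1 \<and> horizon G \<ge> 1 \<and> finite (states G) \<and>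
     (\<forall>m\<in>{1..players G}. finite (actions G m) \<and> actions G m \<noteq> {}) \<and>
     (\<forall>h\<in>{1..horizon G}. \<forall>x\<in>states G. \<forall>a\<in>joint_actions G.
        set_pmf (transition G h x a) \<subseteq> states G)"

definition lex_less :: "('s, 'a::linorder) mdp \<Rightarrow> 'a joint \<Rightarrow> 'a joint \<Rightarrow> bool" where
  "lex_less G a b \<longleftrightarrow> (\<exists>n\<in>{1..players G}. (\<forall>j\<in>{1..<n}. a j = b j) \<and> a n < b n)"

definition learning_rate :: "nat \<Rightarrow> nat \<Rightarrow> real" where
  "learning_rate H t = (real H + 1) / (real H + real t)"

definition weight :: "nat \<Rightarrow> nat \<Rightarrow> nat \<Rightarrow> real" where
  "weight H t i = learning_rate H i * (\<Prod>j=i+1..t. 1 - learning_rate H j)"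

definition bonus :: "nat \<Rightarrow> real \<Rightarrow> real \<Rightarrow> nat \<Rightarrow> real" where
  "bonus H c \<iota> t = c * sqrt (real H ^ 3 * \<iota> / real t)"

text \<open>
  The tables of all players, with arguments in the order step, player, state, joint action.
  The desired sets depend on commonly observed data only and are therefore shared; they are kept
  for each step separately, because elimination at step \<open>h\<close> is decided by the tables of step \<open>h\<close>.
\<close>

record ('s, 'a) tables =
  Qup :: "nat \<Rightarrow> nat \<Rightarrow> 's \<Rightarrow> 'a joint \<Rightarrow> real"
  Qlow :: "nat \<Rightarrow> nat \<Rightarrow> 's \<Rightarrow> 'a joint \<Rightarrow> real"
  N :: "nat \<Rightarrow> nat \<Rightarrow> 's \<Rightarrow> 'a joint \<Rightarrow> nat"
  V :: "nat \<Rightarrow> nat \<Rightarrow> 's \<Rightarrow> real"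
  desired :: "nat \<Rightarrow> 's \<Rightarrow> 'a joint set"

definition initial_tables :: "('s, 'a) mdp \<Rightarrow> ('s, 'a) tables" where
  "initial_tables G = \<lparr>
     Qup = (\<lambda>h m x a. real (horizon G)),
     Qlow = (\<lambda>h m x a. 0),
     N = (\<lambda>h m x a. 0),
     V = (\<lambda>h m x. if h \<le> horizon G then real (horizon G) else 0),
     desired = (\<lambda>h x. joint_actions G)\<rparr>"

text \<open>
  The joint action prescribed at step \<open>h\<close> in state \<open>x\<close>. The counters of different players always
  agree, so each player computes the same action from its own counters. The algorithm does not
  say what to do once a desired set is exhausted; any joint action is allowed then.
\<close>

definition prescribed ::
  "('s, 'a::linorder) mdp \<Rightarrow> ('s, 'a) tables \<Rightarrow> nat \<Rightarrow> 's \<Rightarrow> 'a joint \<Rightarrow> bool" where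
  "prescribed G T h x a \<longleftrightarrow>
     (if desired T h x = {} then a \<in> joint_actions G
      else a \<in> desired T h x \<and>
        (\<forall>m\<in>{1..players G}. \<forall>a'\<in>desired T h x - {a}.
           N T h m x a < N T h m x a' \<or> N T h m x a = N T h m x a' \<and> lex_less G a a'))"

definition wants_to_deviate ::
  "('s, 'a) mdp \<Rightarrow> ('s, 'a) tables \<Rightarrow> nat \<Rightarrow> 's \<Rightarrow> 'a joint \<Rightarrow> nat \<Rightarrow> bool" where
  "wants_to_deviate G T h x a m \<longleftrightarrow> (\<exists>a'\<in>joint_actions G. Qup T h m x a < Qlow T h m x a')"

text \<open>
  \<open>b\<close> is a joint action that may be realized when \<open>a\<close> is prescribed. A deviating player may choose
  any other action of its own; one that has no other action cannot but play its component of \<open>a\<close>.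
\<close>

definition realizable ::
  "('s, 'a) mdp \<Rightarrow> ('s, 'a) tables \<Rightarrow> nat \<Rightarrow> 's \<Rightarrow> 'a joint \<Rightarrow> 'a joint \<Rightarrow> bool" where
  "realizable G T h x a b \<longleftrightarrow>
     b \<in> joint_actions G \<and>
     (\<forall>m\<in>{1..players G}.
        if wants_to_deviate G T h x a m \<and> actions G m \<noteq> {a m} then b m \<noteq> a m else b m = a m)"

definition eliminate ::
  "nat \<Rightarrow> 's \<Rightarrow> 'a joint \<Rightarrow> 'a joint \<Rightarrow> ('s, 'a) tables \<Rightarrow> ('s, 'a) tables" where
  "eliminate h x a b T =
     T\<lparr>desired := (\<lambda>k z. if k = h \<and> z = x \<and> b \<noteq> a then desired T k z - {a} else desired T k z)\<rparr>"

definition count_visit :: "nat \<Rightarrow> 's \<Rightarrow> 'a joint \<Rightarrow> ('s, 'a) tables \<Rightarrow> ('s, 'a) tables" where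
  "count_visit h x b T =
     T\<lparr>N := (\<lambda>k m z d. if k = h \<and> z = x \<and> d = b then N T k m z d + 1 else N T k m z d)\<rparr>"

definition update_Q ::
  "nat \<Rightarrow> real \<Rightarrow> real \<Rightarrow> nat \<Rightarrow> 's \<Rightarrow> 'a joint \<Rightarrow> (nat \<Rightarrow> real) \<Rightarrow> 's
     \<Rightarrow> ('s, 'a) tables \<Rightarrow> ('s, 'a) tables" where
  "update_Q H c \<iota> h x b r y T =
     T\<lparr>Qup := (\<lambda>k m z d.
          if k = h \<and> z = x \<and> d = b then
            let t = N T h m x b; \<alpha> = learning_rate H t
            in (1 - \<alpha>) * Qup T h m x b + \<alpha> * (r m + V T (h + 1) m y + bonus H c \<iota> t)
          else Qup T k m z d),
       Qlow := (\<lambda>k m z d.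
          if k = h \<and> z = x \<and> d = b then
            let t = N T h m x b; \<alpha> = learning_rate H t
            in (1 - \<alpha>) * Qlow T h m x b + \<alpha> * (r m + V T (h + 1) m y - bonus H c \<iota> t)
          else Qlow T k m z d)\<rparr>"

definition update_V :: "('s, 'a) mdp \<Rightarrow> nat \<Rightarrow> 's \<Rightarrow> ('s, 'a) tables \<Rightarrow> ('s, 'a) tables" where
  "update_V G h x T =
     T\<lparr>V := (\<lambda>k m z.
          if k = h \<and> z = x
          then min (real (horizon G)) (Max ((\<lambda>a'. Qup T h m x a') ` joint_actions G))
          else V T k m z)\<rparr>"

text \<open>
  \<open>mQ_run G c \<iota> w T h x\<close>: in some run of the algorithm, with arbitrary initial states of the
  episodes, the steps played so far form the list \<open>w\<close> of triples (step, state, realized joint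
  action), the tables are \<open>T\<close>, and the current episode is about to play step \<open>h\<close> in state \<open>x\<close>
  (it is over if \<open>h\<close> exceeds the horizon by one). Runs are taken pathwise: the next state is any
  state of positive transition probability, the rewards are any numbers in the unit interval.
\<close>

inductive mQ_run ::
  "('s, 'a::linorder) mdp \<Rightarrow> real \<Rightarrow> real \<Rightarrow> (nat \<times> 's \<times> 'a joint) list
     \<Rightarrow> ('s, 'a) tables \<Rightarrow> nat \<Rightarrow> 's \<Rightarrow> bool"
  for G :: "('s, 'a::linorder) mdp" and c \<iota> :: real where
  start: "x \<in> states G \<Longrightarrow> mQ_run G c \<iota> [] (initial_tables G) 1 x"
| step: "\<lbrakk>mQ_run G c \<iota> w T h x; h \<le> horizon G;
    prescribed G T h x a; realizable G T h x a b;
    \<forall>m\<in>{1..players G}. r m \<in> {0..1}; y \<in> set_pmf (transition G h x b);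
    T' = update_V G h x (update_Q (horizon G) c \<iota> h x b r y
           (count_visit h x b (eliminate h x a b T)))\<rbrakk>
    \<Longrightarrow> mQ_run G c \<iota> (w @ [(h, x, b)]) T' (h + 1) y"
| next_episode: "\<lbrakk>mQ_run G c \<iota> w T (horizon G + 1) y; x \<in> states G\<rbrakk>
    \<Longrightarrow> mQ_run G c \<iota> w T 1 x"

definition visits :: "(nat \<times> 's \<times> 'a joint) list \<Rightarrow> nat \<Rightarrow> 's \<Rightarrow> 'a joint \<Rightarrow> nat" where
  "visits w h x a = count_list w (h, x, a)"

end

theory Submission
  imports Defs
begin

text \<open>
  Both tables are updated with the same target up to the sign of the bonus, so their gap \<open>D\<^sub>t\<close> satisfies
  \<open>D\<^sub>t = (1 - \<alpha>\<^sub>t) D\<^sub>t\<^sub>-\<^sub>1 + 2 \<alpha>\<^sub>t b\<^sub>t\<close>. With \<open>D\<^sub>0 = H\<close> this unrolls to the claimed sum plus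
  \<open>H\<close> times the product of the factors \<open>1 - \<alpha>\<^sub>j\<close>, which vanishes once \<open>t \<ge> 1\<close> because \<open>\<alpha>\<^sub>1 = 1\<close>.
\<close>

text \<open>Passing from \<open>t\<close> to \<open>Suc t\<close> multiplies every old weight by one
  more factor; the new last weight has an empty product.\<close>

lemma sum_weight_Suc:
  "(\<Sum>i=1..Suc t. weight H (Suc t) i * f i) =
   (1 - learning_rate H (Suc t)) * (\<Sum>i=1..t. weight H t i * f i) + learning_rate H (Suc t) * f (Suc t)"
proof -
  have "weight H (Suc t) i = (1 - learning_rate H (Suc t)) * weight H t i" if "i \<le> t" for i
    using that by (simp add: weight_def)
  then show ?thesis
    by (simp add: sum_distrib_left mult.assoc weight_def[of H "Suc t" "Suc t"])
qed

lemma prod_one_minus_learning_rate: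
  assumes "t \<ge> 1"
  shows "(\<Prod>j=1..t. 1 - learning_rate H j) = 0"
proof -
  have "learning_rate H 1 = 1"
    by (simp add: learning_rate_def)
  then show ?thesis
    using assms by (auto intro!: prod_zero)
qed

text \<open>\<open>update_Q\<close> reads its time index from the table \<open>N\<close>, while the
  gap is expressed through the history \<open>w\<close>.\<close>

lemma mQ_run_counter:
  assumes "mQ_run G c \<iota> w T h' x'"
  shows "N T h m x a = visits w h x a"
  using assms
  by induction (auto simp: initial_tables_def visits_def update_V_def update_Q_def
      count_visit_def eliminate_def)

text \<open>Keeping the product makes the invariant hold for unvisited pairs too, where it is empty
  and leaves the initial gap.\<close>

lemma mQ_run_gap:
  assumes "mQ_run G c \<iota> w T h' x'"
  shows "Qup T h m x a - Qlow T h m x a =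
    real (horizon G) * (\<Prod>j=1..visits w h x a. 1 - learning_rate (horizon G) j) +
    2 * (\<Sum>i=1..visits w h x a. weight (horizon G) (visits w h x a) i * bonus (horizon G) c \<iota> i)"
  using assms
proof induction
  case (start x')
  then show ?case
    by (simp add: initial_tables_def visits_def)
next
  case (step w T k z d b r y T')
  show ?case
  proof (cases "k = h \<and> z = x \<and> b = a")
    case True
    let ?t = "visits w h x a"
    let ?\<alpha> = "learning_rate (horizon G) (Suc ?t)"
    have counter: "N T h m x a = ?t"
      using step.hyps(1) by (rule mQ_run_counter)
    have visits: "visits (w @ [(k, z, b)]) h x a = Suc ?t"
      using True by (simp add: visits_def)
    \<comment> \<open>The visit is counted before the update, hence the index \<open>Suc ?t\<close>;
      the common target \<open>r m + V T (h + 1) m y\<close> cancels.\<close>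
    have "Qup T' h m x a - Qlow T' h m x a =
        (1 - ?\<alpha>) * (Qup T h m x a - Qlow T h m x a) + 2 * (?\<alpha> * bonus (horizon G) c \<iota> (Suc ?t))"
      using True
      by (simp add: step.hyps update_V_def update_Q_def count_visit_def eliminate_def counter
          Let_def algebra_simps)
    then show ?thesis
      unfolding step.IH visits sum_weight_Suc by (simp add: algebra_simps)
  next
    case False
    then have "Qup T' h m x a = Qup T h m x a" "Qlow T' h m x a = Qlow T h m x a"
      by (auto simp: step.hyps update_V_def update_Q_def count_visit_def eliminate_def)
    moreover have "visits (w @ [(k, z, b)]) h x a = visits w h x a"
      using False by (auto simp: visits_def)
    ultimately show ?thesis
      using step.IH by simp
  qed
next
  case next_episode
  then show ?case
    by simp
qed

theorem lemma13:
  fixes G :: "('s, 'a::linorder) mdp"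
    and c \<iota> :: real
    and w :: "(nat \<times> 's \<times> 'a joint) list"
    and T :: "('s, 'a) tables"
    and h' m h t :: nat
    and x' x :: 's
    and a :: "'a joint"
  assumes "episodic_mdp G"
    and "c > 0" and "\<iota> > 0"
    and "mQ_run G c \<iota> w T h' x'"
    and "m \<in> {1..players G}" and "h \<in> {1..horizon G}"
    and "x \<in> states G" and "a \<in> joint_actions G"
    and "t \<ge> 1" and "visits w h x a = t"
  shows "Qup T h m x a - Qlow T h m x a =
    2 * (\<Sum>i=1..t. weight (horizon G) t i * bonus (horizon G) c \<iota> i)"
  using mQ_run_gap[OF assms(4), of h m x a] prod_one_minus_learning_rate[OF assms(9)] assms(10)
  by simp

end
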